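(* Let $G=H\times\langle a\rangle$, where $H$ is an abelian group of odd order and $\langle a\rangle\cong\mathbb{Z}_2$. If $\mathcal{A}$ is an S-ring over $G$ with $\underline{H}\in\mathcal{A}$ and $\underline{\{a\}}\notin\mathcal{A}$, then $\mathcal{A}$ is the $H/L$-wreath product for some subgroup $L\le H$ with $L\ne 1$ (in particular $L$ is an $\mathcal{A}$-subgroup).
   Context: All groups are finite. For $X\subseteq G$, $\underline{X}=\sum_{x\in X}x\in\mathbb{Z}G$. An S-ring over $G$ is a subring $\mathcal{A}$ of $\mathbb{Z}G$ for which there is a partition $\mathcal{S}(\mathcal{A})$ of $G$ (the basic sets) such that $\{1_G\}\in\mathcal{S}(\mathcal{A})$, $X^{-1}\in\mathcal{S}(\mathcal{A})$ whenever $X\in\mathcal{S}(\mathcal{A})$, and $\mathcal{A}$ is the $\mathbb{Z}$-span of $\{\underline{X}:X\in\mathcal{S}(\mathcal{A})\}$. A subgroup $U\le G$ is an $\mathcal{A}$-subgroup if $\underline{U}\in\mathcal{A}$. For $\mathcal{A}$-subgroups $L\le U$, $\mathcal{A}$ is the $U/L$-wreath product if $L\trianglelefteq G$ and every basic set $X\in\mathcal{S}(\mathcal{A})$ with $X\subseteq G\setminus U$ is a union of $L$-cosets. *)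

theory Defs
  imports "HOL-Algebra.Free_Abelian_Groups" "HOL-Algebra.Subrings" "HOL-Algebra.Elementary_Groups"
    "HOL-Library.Disjoint_Sets"
begin

section \<open>Internal direct products\<close>

definition internal_direct_product ::
    "('a, 'b) monoid_scheme \<Rightarrow> 'a set \<Rightarrow> 'a set \<Rightarrow> bool" where
  "internal_direct_product G H K \<longleftrightarrow>
     H \<lhd> G \<and> K \<lhd> G \<and> H \<inter> K = {\<one>\<^bsub>G\<^esub>} \<and> H <#>\<^bsub>G\<^esub> K = carrier G"

section \<open>The integral group ring\<close>

text \<open>
  The additive group is that of \<^const>\<open>free_Abelian_group\<close> on the carrier of \<open>G\<close>. Multiplication is
  the bilinear extension of the group multiplication. (The multiplication that \<open>Poly_Mapping\<close>
  provides on finitely supported functions is not used, since it needs the group operation to come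
  from a type class.)
\<close>

definition group_ring :: "('a, 'b) monoid_scheme \<Rightarrow> ('a \<Rightarrow>\<^sub>0 int) ring" where
  "group_ring G =
     \<lparr>carrier = carrier (free_Abelian_group (carrier G)),
      monoid.mult = (\<lambda>x y. frag_extend (\<lambda>g. frag_extend (\<lambda>h. frag_of (g \<otimes>\<^bsub>G\<^esub> h)) y) x),
      monoid.one = frag_of \<one>\<^bsub>G\<^esub>,
      ring.zero = 0,
      ring.add = (+)\<rparr>"

lemma group_ring_simps [simp]:
  "x \<in> carrier (group_ring G) \<longleftrightarrow> Poly_Mapping.keys x \<subseteq> carrier G"
  "\<one>\<^bsub>group_ring G\<^esub> = frag_of \<one>\<^bsub>G\<^esub>"
  "\<zero>\<^bsub>group_ring G\<^esub> = 0"
  "x \<oplus>\<^bsub>group_ring G\<^esub> y = x + y"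
  by (simp_all add: group_ring_def)

lemmas group_ring_induct =
  free_Abelian_group_induct[of _ "carrier G" for G, consumes 1, case_names zero diff one]

lemma group_ring_mult:
  "x \<otimes>\<^bsub>group_ring G\<^esub> y = frag_extend (\<lambda>g. frag_extend (\<lambda>h. frag_of (g \<otimes>\<^bsub>G\<^esub> h)) y) x"
  by (simp add: group_ring_def)

lemma group_ring_mult_frag_of [simp]:
  "frag_of g \<otimes>\<^bsub>group_ring G\<^esub> frag_of h = frag_of (g \<otimes>\<^bsub>G\<^esub> h)"
  by (simp add: group_ring_mult)

lemma group_ring_zero_mult [simp]:
  "0 \<otimes>\<^bsub>group_ring G\<^esub> y = 0" "x \<otimes>\<^bsub>group_ring G\<^esub> 0 = 0"
  by (simp_all add: group_ring_mult frag_extend_def)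

lemma group_ring_distrib:
  "(x + y) \<otimes>\<^bsub>group_ring G\<^esub> z = x \<otimes>\<^bsub>group_ring G\<^esub> z + y \<otimes>\<^bsub>group_ring G\<^esub> z"
  "x \<otimes>\<^bsub>group_ring G\<^esub> (y + z) = x \<otimes>\<^bsub>group_ring G\<^esub> y + x \<otimes>\<^bsub>group_ring G\<^esub> z"
  "(x - y) \<otimes>\<^bsub>group_ring G\<^esub> z = x \<otimes>\<^bsub>group_ring G\<^esub> z - y \<otimes>\<^bsub>group_ring G\<^esub> z"
  "x \<otimes>\<^bsub>group_ring G\<^esub> (y - z) = x \<otimes>\<^bsub>group_ring G\<^esub> y - x \<otimes>\<^bsub>group_ring G\<^esub> z"
proof -
  have "frag_cmul c (u - v) = frag_cmul c u - frag_cmul c v" for c and u v :: "'a \<Rightarrow>\<^sub>0 int"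
    by (metis frag_cmul_distrib2 add_diff_cancel_right' diff_add_cancel)
  then have "frag_extend (\<lambda>g. k g - l g) c = frag_extend k c - frag_extend l c"
    for k l :: "'a \<Rightarrow> ('a \<Rightarrow>\<^sub>0 int)" and c
    by (simp add: frag_extend_def sum_subtractf)
  moreover have "frag_extend (\<lambda>g. k g + l g) c = frag_extend k c + frag_extend l c"
    for k l :: "'a \<Rightarrow> ('a \<Rightarrow>\<^sub>0 int)" and c
    by (simp add: frag_extend_def sum.distrib frag_cmul_distrib2)
  ultimately show "(x + y) \<otimes>\<^bsub>group_ring G\<^esub> z = x \<otimes>\<^bsub>group_ring G\<^esub> z + y \<otimes>\<^bsub>group_ring G\<^esub> z"
    "x \<otimes>\<^bsub>group_ring G\<^esub> (y + z) = x \<otimes>\<^bsub>group_ring G\<^esub> y + x \<otimes>\<^bsub>group_ring G\<^esub> z"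
    "(x - y) \<otimes>\<^bsub>group_ring G\<^esub> z = x \<otimes>\<^bsub>group_ring G\<^esub> z - y \<otimes>\<^bsub>group_ring G\<^esub> z"
    "x \<otimes>\<^bsub>group_ring G\<^esub> (y - z) = x \<otimes>\<^bsub>group_ring G\<^esub> y - x \<otimes>\<^bsub>group_ring G\<^esub> z"
    by (simp_all add: group_ring_mult frag_extend_add frag_extend_diff)
qed

lemma ring_group_ring:
  assumes "group G"
  shows "ring (group_ring G)"
proof -
  interpret group G by fact
  let ?R = "group_ring G"
  have closed: "Poly_Mapping.keys (x \<otimes>\<^bsub>?R\<^esub> y) \<subseteq> carrier G"
    if "Poly_Mapping.keys x \<subseteq> carrier G" "Poly_Mapping.keys y \<subseteq> carrier G" for x y
    using that(1)
  proof (induction x rule: group_ring_induct)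
    case (one g)
    show ?case
      using that(2)
    proof (induction y rule: group_ring_induct)
      case (diff u v)
      then show ?case
        by (auto simp: group_ring_distrib dest!: subsetD[OF keys_diff])
    qed (use one in auto)
  next
    case (diff u v)
    then show ?case
      by (auto simp: group_ring_distrib dest!: subsetD[OF keys_diff])
  qed auto
  have assoc: "(x \<otimes>\<^bsub>?R\<^esub> y) \<otimes>\<^bsub>?R\<^esub> z = x \<otimes>\<^bsub>?R\<^esub> (y \<otimes>\<^bsub>?R\<^esub> z)"
    if "Poly_Mapping.keys x \<subseteq> carrier G" "Poly_Mapping.keys y \<subseteq> carrier G"
       "Poly_Mapping.keys z \<subseteq> carrier G" for x y z
    using that(1)
  proof (induction x rule: group_ring_induct)
    case (one g)
    show ?case
      using that(2)
    proof (induction y rule: group_ring_induct)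
      case (one h)
      show ?case
        using that(3)
        by (induction z rule: group_ring_induct)
           (use \<open>g \<in> carrier G\<close> one in \<open>auto simp: group_ring_distrib m_assoc\<close>)
    qed (auto simp: group_ring_distrib)
  qed (auto simp: group_ring_distrib)
  have one_l: "frag_of \<one>\<^bsub>G\<^esub> \<otimes>\<^bsub>?R\<^esub> x = x" if "Poly_Mapping.keys x \<subseteq> carrier G" for x
    using that by (induction x rule: group_ring_induct) (auto simp: group_ring_distrib)
  have one_r: "x \<otimes>\<^bsub>?R\<^esub> frag_of \<one>\<^bsub>G\<^esub> = x" if "Poly_Mapping.keys x \<subseteq> carrier G" for x
    using that by (induction x rule: group_ring_induct) (auto simp: group_ring_distrib)
  show ?thesis
  proof (rule ringI)
    show "abelian_group ?R"
    proof (rule abelian_groupI)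
      fix x assume "x \<in> carrier ?R"
      then show "\<exists>y\<in>carrier ?R. y \<oplus>\<^bsub>?R\<^esub> x = \<zero>\<^bsub>?R\<^esub>"
        by (intro bexI[of _ "- x"]) auto
    qed (auto simp: algebra_simps dest!: subsetD[OF keys_add])
    show "monoid ?R"
      by (rule monoidI) (use closed assoc one_l one_r in simp_all)
  qed (simp_all add: group_ring_distrib)
qed

section \<open>S-rings\<close>

text \<open>The element \<open>\<Sum>x\<in>X. x\<close> of the group ring.\<close>

definition simple_quantity :: "'a set \<Rightarrow> ('a \<Rightarrow>\<^sub>0 int)" where
  "simple_quantity X = sum frag_of X"

definition S_partition ::
    "('a, 'b) monoid_scheme \<Rightarrow> ('a \<Rightarrow>\<^sub>0 int) set \<Rightarrow> 'a set set \<Rightarrow> bool" where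
  "S_partition G A S \<longleftrightarrow>
     partition_on (carrier G) S \<and>
     {\<one>\<^bsub>G\<^esub>} \<in> S \<and>
     (\<forall>X\<in>S. set_inv\<^bsub>G\<^esub> X \<in> S) \<and>
     A = Modules.module.span frag_cmul (simple_quantity ` S)"

definition S_ring :: "('a, 'b) monoid_scheme \<Rightarrow> ('a \<Rightarrow>\<^sub>0 int) set \<Rightarrow> bool" where
  "S_ring G A \<longleftrightarrow> subring A (group_ring G) \<and> (\<exists>S. S_partition G A S)"

text \<open>For finite \<open>G\<close> the partition is determined by \<open>A\<close>; see \<open>basic_sets_eq\<close> below.\<close>

definition basic_sets :: "('a, 'b) monoid_scheme \<Rightarrow> ('a \<Rightarrow>\<^sub>0 int) set \<Rightarrow> 'a set set" where
  "basic_sets G A = (THE S. S_partition G A S)"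

definition A_subgroup ::
    "('a, 'b) monoid_scheme \<Rightarrow> ('a \<Rightarrow>\<^sub>0 int) set \<Rightarrow> 'a set \<Rightarrow> bool" where
  "A_subgroup G A U \<longleftrightarrow> subgroup U G \<and> simple_quantity U \<in> A"

text \<open>\<open>wreath_product G A U L\<close>: the S-ring \<open>A\<close> over \<open>G\<close> is the \<open>U/L\<close>-wreath product.\<close>

definition wreath_product ::
    "('a, 'b) monoid_scheme \<Rightarrow> ('a \<Rightarrow>\<^sub>0 int) set \<Rightarrow> 'a set \<Rightarrow> 'a set \<Rightarrow> bool" where
  "wreath_product G A U L \<longleftrightarrow>
     A_subgroup G A U \<and> A_subgroup G A L \<and> L \<subseteq> U \<and> L \<lhd> G \<and>
     (\<forall>X\<in>basic_sets G A. X \<subseteq> carrier G - U \<longrightarrow> (\<exists>C\<subseteq>rcosets\<^bsub>G\<^esub> L. X = \<Union>C))"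

lemma module_frag_cmul: "Modules.module (frag_cmul :: int \<Rightarrow> ('a \<Rightarrow>\<^sub>0 int) \<Rightarrow> _)"
  by unfold_locales (simp_all add: frag_cmul_distrib frag_cmul_distrib2)

lemma lookup_simple_quantity:
  assumes "finite X"
  shows "Poly_Mapping.lookup (simple_quantity X) g = (if g \<in> X then 1 else 0)"
  using assms
  by (auto simp: simple_quantity_def lookup_sum lookup_single when_def)

lemma S_partition_eq:
  assumes "finite (carrier G)" and "S_partition G A S"
  shows "S = (\<lambda>x. {y \<in> carrier G. \<forall>f\<in>A. Poly_Mapping.lookup f y = Poly_Mapping.lookup f x}) ` carrier G"
proof -
  from assms(2) have P: "partition_on (carrier G) S"
    and A: "A = Modules.module.span frag_cmul (simple_quantity ` S)"
    by (auto simp: S_partition_def)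
  interpret fr: Modules.module "frag_cmul :: int \<Rightarrow> ('a \<Rightarrow>\<^sub>0 int) \<Rightarrow> _" by (rule module_frag_cmul)
  have fin: "finite X" if "X \<in> S" for X
    using that partition_onD1[OF P] assms(1) by (metis Union_upper finite_subset)
  have uniq: "X = Y" if "X \<in> S" "Y \<in> S" "z \<in> X" "z \<in> Y" for X Y z
    using that partition_onD2[OF P] by (auto simp: disjoint_def)
  have const: "Poly_Mapping.lookup f y = Poly_Mapping.lookup f x"
    if "f \<in> A" "X \<in> S" "x \<in> X" "y \<in> X" for f X x y
    using that(1) unfolding A
  proof (induction rule: fr.span_induct_alt)
    case base
    then show ?case by simp
  next
    case (step c u v)
    then obtain Z where Z: "Z \<in> S" "u = simple_quantity Z" by auto
    then have "x \<in> Z \<longleftrightarrow> y \<in> Z" using uniq that by metis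
    then show ?case
      using step Z by (simp add: lookup_add lookup_simple_quantity[OF fin])
  qed
  have cls: "{y \<in> carrier G. \<forall>f\<in>A. Poly_Mapping.lookup f y = Poly_Mapping.lookup f x} = X"
    if "X \<in> S" "x \<in> X" for X x
  proof
    show "X \<subseteq> {y \<in> carrier G. \<forall>f\<in>A. Poly_Mapping.lookup f y = Poly_Mapping.lookup f x}"
      using const that partition_onD1[OF P] by blast
    have "simple_quantity X \<in> A"
      unfolding A using that by (auto intro: fr.span_base)
    then show "{y \<in> carrier G. \<forall>f\<in>A. Poly_Mapping.lookup f y = Poly_Mapping.lookup f x} \<subseteq> X"
      using that lookup_simple_quantity[OF fin[OF that(1)]] by (auto split: if_splits)
  qed
  show ?thesis
  proof
    show "S \<subseteq> (\<lambda>x. {y \<in> carrier G. \<forall>f\<in>A. Poly_Mapping.lookup f y = Poly_Mapping.lookup f x}) ` carrier G"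
    proof
      fix X assume X: "X \<in> S"
      with partition_onD3[OF P] obtain x where "x \<in> X" by (metis ex_in_conv)
      with X show "X \<in> (\<lambda>x. {y \<in> carrier G. \<forall>f\<in>A. Poly_Mapping.lookup f y = Poly_Mapping.lookup f x}) ` carrier G"
        using cls[of X x] partition_onD1[OF P] by (intro image_eqI[of _ _ x]) auto
    qed
    show "(\<lambda>x. {y \<in> carrier G. \<forall>f\<in>A. Poly_Mapping.lookup f y = Poly_Mapping.lookup f x}) ` carrier G \<subseteq> S"
      using cls partition_onD1[OF P] by auto
  qed
qed

lemma basic_sets_eq:
  assumes "finite (carrier G)" and "S_partition G A S"
  shows "basic_sets G A = S"
  unfolding basic_sets_def
proof (rule the_equality)
  show "T = S" if "S_partition G A T" for T
    unfolding S_partition_eq[OF assms(1) that] S_partition_eq[OF assms] ..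
qed fact

lemma S_partition_basic_sets:
  assumes "finite (carrier G)" and "S_ring G A"
  shows "S_partition G A (basic_sets G A)"
  using assms basic_sets_eq[OF assms(1)] by (auto simp: S_ring_def)

end

theory Submission
  imports Defs "HOL-Number_Theory.Residues"
begin

text \<open>
  Let \<open>X\<close> be a basic set outside \<open>H\<close>. Modulo 2, the square of \<open>simple_quantity X\<close> is the sum of the
  squares of the elements of \<open>X\<close>, so squaring maps \<open>\<A>\<close>-sets on which it is injective to \<open>\<A>\<close>-sets.
  Squaring is injective on both cosets of \<open>H\<close>, and its \<open>k\<close>-th iterate maps \<open>X\<close> to \<open>X a\<close> if
  \<open>2 ^ k\<close> is congruent to 1 modulo the order of \<open>H\<close>; hence \<open>W = X a \<subseteq> H\<close> is an \<open>\<A>\<close>-set.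
  Consequently \<open>W\<^sup>-\<^sup>1 X\<close> lies in \<open>\<A>\<close>. Its coefficient at \<open>a\<close> has the largest possible value \<open>|W|\<close>, and
  so has its coefficient at every \<open>y a\<close> in the basic set \<open>L a\<close> of \<open>a\<close>, which says that \<open>X y = X\<close>.
  For \<open>X = L a\<close> this shows that \<open>L\<close> is a subgroup, for general \<open>X\<close> that \<open>X\<close> is a union of
  \<open>L\<close>-cosets.
\<close>

section \<open>Products of simple quantities in the group ring\<close>

lemma simple_quantity_empty [simp]: "simple_quantity {} = 0"
  by (simp add: simple_quantity_def)

lemma simple_quantity_insert:
  "finite X \<Longrightarrow> z \<notin> X \<Longrightarrow> simple_quantity (insert z X) = frag_of z + simple_quantity X"
  by (simp add: simple_quantity_def)

lemma simple_quantity_mult: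
  assumes "finite X" "finite Y"
  shows "simple_quantity X \<otimes>\<^bsub>group_ring G\<^esub> simple_quantity Y = (\<Sum>x\<in>X. \<Sum>y\<in>Y. frag_of (x \<otimes>\<^bsub>G\<^esub> y))"
proof -
  have "frag_of x \<otimes>\<^bsub>group_ring G\<^esub> simple_quantity Y = (\<Sum>y\<in>Y. frag_of (x \<otimes>\<^bsub>G\<^esub> y))" for x
    using assms(2) by induction (simp_all add: simple_quantity_insert group_ring_distrib)
  with assms(1) show ?thesis
    by (induction X) (simp_all add: simple_quantity_insert group_ring_distrib)
qed

text \<open>Commutativity pairs each off-diagonal product \<open>x \<otimes> y\<close> with the
  equal product \<open>y \<otimes> x\<close>, so everything except the squares is counted
  twice.\<close>

lemma (in comm_monoid) simple_quantity_square:
  assumes "finite X" "X \<subseteq> carrier G"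
  shows "\<exists>u. simple_quantity X \<otimes>\<^bsub>group_ring G\<^esub> simple_quantity X = (\<Sum>x\<in>X. frag_of (x \<otimes> x)) + (u + u)"
  using assms
proof (induction X)
  case empty
  then show ?case by (auto intro: exI[of _ 0])
next
  case (insert z X)
  then obtain u where
    u: "simple_quantity X \<otimes>\<^bsub>group_ring G\<^esub> simple_quantity X = (\<Sum>x\<in>X. frag_of (x \<otimes> x)) + (u + u)"
    by auto
  have "simple_quantity X \<otimes>\<^bsub>group_ring G\<^esub> frag_of z = frag_of z \<otimes>\<^bsub>group_ring G\<^esub> simple_quantity X"
    using simple_quantity_mult[of X "{z}" G] simple_quantity_mult[of "{z}" X G] insert.hyps insert.prems
    by (simp add: simple_quantity_def m_comm subset_iff)
  then have "simple_quantity (insert z X) \<otimes>\<^bsub>group_ring G\<^esub> simple_quantity (insert z X) =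
      (\<Sum>x\<in>insert z X. frag_of (x \<otimes> x)) +
      ((frag_of z \<otimes>\<^bsub>group_ring G\<^esub> simple_quantity X + u) + (frag_of z \<otimes>\<^bsub>group_ring G\<^esub> simple_quantity X + u))"
    using insert.hyps by (simp add: simple_quantity_insert group_ring_distrib u algebra_simps)
  then show ?case by blast
qed

text \<open>For each \<open>x \<in> X\<close> the equation \<open>x \<otimes> y = g\<close> has
  exactly one solution, \<open>inv x \<otimes> g\<close>, so \<open>x\<close> contributes 1 or 0
  according to whether it lies in \<open>Y\<close>.\<close>

lemma (in group) lookup_simple_quantity_mult:
  assumes "finite X" "X \<subseteq> carrier G" "finite Y" "Y \<subseteq> carrier G" "g \<in> carrier G"
  shows "Poly_Mapping.lookup (simple_quantity X \<otimes>\<^bsub>group_ring G\<^esub> simple_quantity Y) g =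
    int (card {x \<in> X. inv x \<otimes> g \<in> Y})"
proof -
  have "(\<Sum>y\<in>Y. Poly_Mapping.lookup (frag_of (x \<otimes> y)) g) = (if inv x \<otimes> g \<in> Y then 1 else 0)"
    if "x \<in> X" for x
  proof -
    have lookup_frag_of: "Poly_Mapping.lookup (frag_of z) g = (if z = g then 1 else 0)" for z
      by (simp add: lookup_single when_def)
    have "x \<otimes> y = g \<longleftrightarrow> inv x \<otimes> g = y" if "y \<in> Y" for y
      using that \<open>x \<in> X\<close> assms inv_solve_left' by (metis subsetD)
    then have "(\<Sum>y\<in>Y. Poly_Mapping.lookup (frag_of (x \<otimes> y)) g) =
        (\<Sum>y\<in>Y. if inv x \<otimes> g = y then 1 else 0)"
      unfolding lookup_frag_of by (intro sum.cong refl if_cong)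
    then show ?thesis using assms(3) by simp
  qed
  then show ?thesis
    using assms(1) by (simp add: simple_quantity_mult[OF assms(1,3)] lookup_sum sum.If_cases Int_def)
qed

section \<open>Unions of basic sets and the operations that preserve them\<close>

locale S_ring_over = group G for G :: "('a, 'b) monoid_scheme" (structure) +
  fixes A :: "('a \<Rightarrow>\<^sub>0 int) set"
  assumes finite_carrier: "finite (carrier G)" and S_ring: "S_ring G A"
begin

abbreviation "S \<equiv> basic_sets G A"

text \<open>By \<open>A_set_mem_iff\<close> and \<open>A_setI\<close> these are exactly the unions
  of basic sets.\<close>

definition A_set :: "'a set \<Rightarrow> bool" where
  "A_set X \<longleftrightarrow> X \<subseteq> carrier G \<and> simple_quantity X \<in> A"

lemma S_partition: "S_partition G A S"
  using finite_carrier S_ring by (rule S_partition_basic_sets)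

lemma partition: "partition_on (carrier G) S"
  using S_partition by (simp add: S_partition_def)

lemma A_eq_span: "A = Modules.module.span frag_cmul (simple_quantity ` S)"
  using S_partition by (simp add: S_partition_def)

lemma basic_set_subset: "X \<in> S \<Longrightarrow> X \<subseteq> carrier G"
  using partition_onD1[OF partition] by auto

lemma basic_set_exists:
  assumes "x \<in> carrier G"
  obtains X where "X \<in> S" "x \<in> X"
  using assms partition_onD1[OF partition] by auto

lemma finite_subset_carrier: "X \<subseteq> carrier G \<Longrightarrow> finite X"
  using finite_carrier finite_subset by blast

lemma basic_set_A_set:
  assumes "X \<in> S"
  shows "A_set X"
proof -
  have "simple_quantity X \<in> A"
    by (subst A_eq_span, rule module.span_base[OF module_frag_cmul]) (use assms in blast)
  then show ?thesis using assms by (simp add: A_set_def basic_set_subset)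
qed

text \<open>By \<open>S_partition_eq\<close> the basic sets are the classes of elements at which all
  members of \<open>A\<close> have equal coefficients.\<close>

lemma lookup_eq:
  assumes "f \<in> A" "B \<in> S" "x \<in> B" "y \<in> B"
  shows "Poly_Mapping.lookup f x = Poly_Mapping.lookup f y"
proof -
  let ?C = "\<lambda>z. {y \<in> carrier G. \<forall>f\<in>A. Poly_Mapping.lookup f y = Poly_Mapping.lookup f z}"
  have "S = ?C ` carrier G" by (rule S_partition_eq[OF finite_carrier S_partition])
  with assms(2) obtain z where "B = ?C z" by blast
  with assms show ?thesis by simp
qed

lemma A_set_mem_iff:
  assumes "A_set X" "B \<in> S" "x \<in> B" "y \<in> B"
  shows "x \<in> X \<longleftrightarrow> y \<in> X"
  using assms lookup_eq[of "simple_quantity X" B x y]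
  by (auto simp: A_set_def lookup_simple_quantity finite_subset_carrier split: if_splits)

text \<open>Closure under basic sets makes \<open>X\<close> the disjoint union of the basic sets it
  contains, so its simple quantity is the sum of theirs.\<close>

lemma A_setI:
  assumes "X \<subseteq> carrier G" and closed: "\<And>B x y. B \<in> S \<Longrightarrow> x \<in> B \<Longrightarrow> y \<in> B \<Longrightarrow> x \<in> X \<Longrightarrow> y \<in> X"
  shows "A_set X"
proof -
  let ?S = "{B \<in> S. B \<subseteq> X}"
  have "x \<in> \<Union>?S" if x: "x \<in> X" for x
  proof -
    obtain B where "B \<in> S" "x \<in> B" using basic_set_exists assms(1) x by blast
    moreover from this have "B \<subseteq> X" using closed x by blast
    ultimately show ?thesis by blast
  qed
  then have X: "X = \<Union>?S" by blast
  have "simple_quantity (\<Union>?S) = sum simple_quantity ?S"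
    unfolding simple_quantity_def
  proof (subst sum.Union_disjoint)
    show "\<forall>B\<in>?S. finite B" using basic_set_subset finite_subset_carrier by blast
    show "\<forall>B\<in>?S. \<forall>C\<in>?S. B \<noteq> C \<longrightarrow> B \<inter> C = {}"
      using partition_onD2[OF partition] by (auto simp: disjoint_def)
  qed auto
  also have "\<dots> \<in> A"
    by (subst A_eq_span, rule module.span_sum[OF module_frag_cmul],
        rule module.span_base[OF module_frag_cmul]) blast
  finally have "simple_quantity X \<in> A" by (subst X)
  with assms(1) show ?thesis by (simp add: A_set_def)
qed

lemma A_set_mult_mem:
  assumes "A_set X" "A_set Y"
  shows "simple_quantity X \<otimes>\<^bsub>group_ring G\<^esub> simple_quantity Y \<in> A"
  using assms S_ring subringE(6) by (auto simp: A_set_def S_ring_def)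

lemma A_set_inv:
  assumes "A_set X"
  shows "A_set (set_inv X)"
proof (rule A_setI)
  show "set_inv X \<subseteq> carrier G" using assms by (auto simp: A_set_def SET_INV_def)
  fix B x y assume B: "B \<in> S" "x \<in> B" "y \<in> B" "x \<in> set_inv X"
  then have "set_inv B \<in> S" using S_partition by (simp add: S_partition_def)
  moreover have "inv x \<in> set_inv B" "inv y \<in> set_inv B" using B by (auto simp: SET_INV_def)
  moreover have "inv x \<in> X" using B assms by (auto simp: SET_INV_def A_set_def)
  ultimately have "inv y \<in> X" using A_set_mem_iff[OF assms] by blast
  moreover have "y = inv (inv y)" using B basic_set_subset[OF B(1)] by auto
  ultimately show "y \<in> set_inv X" by (auto simp: SET_INV_def)
qed

text \<open>By injectivity each square arises once, so the odd coefficients in the square of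
  \<open>simple_quantity X\<close> are exactly those at squares of elements of \<open>X\<close>.
  Coefficients, hence their parities, are constant on basic sets.\<close>

lemma A_set_squares:
  assumes "comm_group G" "A_set X" and inj: "inj_on (\<lambda>x. x \<otimes> x) X"
  shows "A_set ((\<lambda>x. x \<otimes> x) ` X)"
proof (rule A_setI)
  interpret comm_group G by fact
  let ?Q = "(\<lambda>x. x \<otimes> x) ` X"
  have X: "X \<subseteq> carrier G" "finite X" using assms(2) finite_subset_carrier by (auto simp: A_set_def)
  show "?Q \<subseteq> carrier G" using X by auto
  obtain u where "simple_quantity X \<otimes>\<^bsub>group_ring G\<^esub> simple_quantity X = simple_quantity ?Q + (u + u)"
    using simple_quantity_square[OF X(2,1)] inj by (auto simp: simple_quantity_def sum.reindex)
  then have "Poly_Mapping.lookup (simple_quantity X \<otimes>\<^bsub>group_ring G\<^esub> simple_quantity X) g =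
      (if g \<in> ?Q then 1 else 0) + 2 * Poly_Mapping.lookup u g" for g
    using X by (simp add: lookup_add lookup_simple_quantity)
  then have odd_iff: "odd (Poly_Mapping.lookup (simple_quantity X \<otimes>\<^bsub>group_ring G\<^esub> simple_quantity X) g)
      \<longleftrightarrow> g \<in> ?Q" for g
    by (simp)
  show "y \<in> ?Q" if "B \<in> S" "x \<in> B" "y \<in> B" "x \<in> ?Q" for B x y
    using that(4) lookup_eq[OF A_set_mult_mem[OF assms(2,2)] that(1-3)]
    by (metis odd_iff)
qed

end

theorem theorem1p2:
  fixes G :: "('a, 'b) monoid_scheme" (structure)
    and H :: "'a set" and a :: 'a and A :: "('a \<Rightarrow>\<^sub>0 int) set"
  assumes "group G" and "finite (carrier G)"
    and "subgroup H G" and "comm_group (G\<lparr>carrier := H\<rparr>)" and "odd (card H)"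
    and "a \<in> carrier G" and "G\<lparr>carrier := generate G {a}\<rparr> \<cong> integer_mod_group 2"
    and "internal_direct_product G H (generate G {a})"
    and "S_ring G A"
    and "simple_quantity H \<in> A" and "simple_quantity {a} \<notin> A"
  shows "\<exists>L. subgroup L G \<and> L \<subseteq> H \<and> L \<noteq> {\<one>} \<and> wreath_product G A H L"
proof -

  \<comment> \<open>Structure of \<open>G\<close>: \<open>a\<close> is an involution outside
    \<open>H\<close>, and \<open>G\<close> is abelian\<close>
  interpret S_ring_over G A
    using assms by (simp add: S_ring_over_def S_ring_over_axioms_def)
  interpret H: subgroup H G by fact
  let ?K = "generate G {a}"
  from assms(7) have "card ?K = card (carrier (integer_mod_group 2))"
    using iso_same_card by fastforce
  then have cardK: "card ?K = 2"
    by (simp add: carrier_integer_mod_group)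
  have aK: "a \<in> ?K" "\<one> \<in> ?K"
    by (auto intro: generate.incl generate.one)
  have a1: "a \<noteq> \<one>"
    using cardK generate_one by auto
  then have K: "?K = {\<one>, a}"
    using cardK aK by (auto simp: card_2_iff)
  have idp: "?K \<lhd> G" "H \<inter> ?K = {\<one>}" "H <#> ?K = carrier G"
    using assms(8) by (auto simp: internal_direct_product_def)
  have aa: "a \<otimes> a = \<one>"
  proof -
    have "a \<otimes> a \<in> ?K" using aK generate.eng by metis
    then show ?thesis using K a1 assms(6) r_cancel_one' by auto
  qed
  have aH: "a \<notin> H" using idp K a1 by auto
  \<comment> \<open>The conjugate of \<open>a\<close> by \<open>h\<close> lies in the normal
    subgroup \<open>?K\<close>, whose elements are \<open>\<one>\<close> and \<open>a\<close>, and
    it is not \<open>\<one>\<close>.\<close>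
  have comm_a: "h \<otimes> a = a \<otimes> h" if "h \<in> H" for h
  proof -
    have h: "h \<in> carrier G" using that by auto
    have "h \<otimes> a \<otimes> inv h \<in> ?K" using idp(1) h aK normal.inv_op_closed2 by metis
    moreover have "h \<otimes> a \<otimes> inv h \<noteq> \<one>"
    proof
      assume "h \<otimes> a \<otimes> inv h = \<one>"
      then have "inv (inv h) = h \<otimes> a" using h assms(6) by (intro inv_equality) auto
      then show False using h assms(6) a1 by simp
    qed
    ultimately have "h \<otimes> a \<otimes> inv h = a" using K by auto
    then have "h \<otimes> a \<otimes> inv h \<otimes> h = a \<otimes> h" by simp
    then show ?thesis using h assms(6) by (simp add: m_assoc)
  qed
  have comm_H: "h \<otimes> k = k \<otimes> h" if "h \<in> H" "k \<in> H" for h k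
    using comm_groupE(4)[OF assms(4)] that by simp
  have cases_G: "x \<in> H \<or> (\<exists>h\<in>H. x = h \<otimes> a)" if "x \<in> carrier G" for x
    using that idp(3) K by (auto simp: set_mult_def)
  interpret G: comm_group G
  proof (rule group_comm_groupI)
    fix x y assume "x \<in> carrier G" "y \<in> carrier G"
    moreover have "h \<otimes> (k \<otimes> a) = (k \<otimes> a) \<otimes> h" if "h \<in> H" "k \<in> H" for h k
      using that comm_H comm_a assms(6) by (metis H.mem_carrier m_assoc)
    moreover have "(h \<otimes> a) \<otimes> (k \<otimes> a) = h \<otimes> k" if "h \<in> H" "k \<in> H" for h k
    proof -
      have "(h \<otimes> a) \<otimes> (k \<otimes> a) = h \<otimes> (a \<otimes> k) \<otimes> a"
        using that assms(6) by (simp add: m_assoc)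
      also have "\<dots> = h \<otimes> k \<otimes> (a \<otimes> a)"
        using that assms(6) by (simp add: comm_a[symmetric] m_assoc)
      finally show ?thesis using that aa by simp
    qed
    ultimately show "x \<otimes> y = y \<otimes> x"
      using cases_G comm_H by metis
  qed

  \<comment> \<open>Squaring on the two cosets of \<open>H\<close>\<close>
  have aaH: "x \<otimes> a \<in> H" if "x \<in> carrier G" "x \<notin> H" for x
    using that cases_G[OF that(1)] aa assms(6) by (auto simp: m_assoc)
  have sq_a: "z \<otimes> a \<otimes> (z \<otimes> a) = z \<otimes> z" if "z \<in> carrier G" for z
  proof -
    have "z \<otimes> a \<otimes> (z \<otimes> a) = z \<otimes> z \<otimes> (a \<otimes> a)" using that assms(6) by (simp add: G.m_ac)
    then show ?thesis using that aa by simp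
  qed
  have sqH: "x \<otimes> x \<in> H" if "x \<in> carrier G" for x
  proof (cases "x \<in> H")
    case False
    then have "x \<otimes> a \<otimes> (x \<otimes> a) \<in> H" using aaH that by simp
    then show ?thesis using sq_a that by simp
  qed simp
  have pow_card: "h [^] card H = \<one>" if "h \<in> H" for h
    using group.pow_order_eq_1[OF subgroup.subgroup_is_group[OF assms(3,1)], of h] that
    by (simp add: order_def nat_pow_consistent[symmetric])
  have inj_H: "h = k" if "h \<in> H" "k \<in> H" "h \<otimes> h = k \<otimes> k" for h k
  proof -
    \<comment> \<open>Since \<open>card H\<close> is odd, raising to the power \<open>n\<close>
      undoes squaring on \<open>H\<close>.\<close>
    obtain n where n: "card H + 1 = 2 * n"
      using assms(5) by (metis even_add evenE odd_one)
    have "x = (x \<otimes> x) [^] n" if "x \<in> H" for x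
    proof -
      have "x = x [^] (card H + 1)" using that pow_card by simp
      also have "\<dots> = (x [^] (2::nat)) [^] n" using that n by (simp add: nat_pow_pow)
      finally show ?thesis using that by (simp add: numeral_2_eq_2)
    qed
    then show ?thesis using that by metis
  qed
  have inj: "inj_on (\<lambda>x. x \<otimes> x) Z" if "Z \<subseteq> carrier G" "Z \<subseteq> H \<or> Z \<inter> H = {}" for Z
  proof (rule inj_onI)
    fix x y assume xy: "x \<in> Z" "y \<in> Z" "x \<otimes> x = y \<otimes> y"
    then have xyc: "x \<in> carrier G" "y \<in> carrier G" using that by auto
    show "x = y"
    proof (cases "Z \<subseteq> H")
      case True
      then show ?thesis using xy inj_H by auto
    next
      case False
      \<comment> \<open>Multiplication by \<open>a\<close> moves both elements into \<open>H\<close>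
        without changing their squares.\<close>
      with that(2) xy have "x \<notin> H" "y \<notin> H" by auto
      then have "x \<otimes> a = y \<otimes> a"
        by - (rule inj_H[OF aaH aaH], simp_all only: sq_a xyc xy(3) not_False_eq_True)
      then show ?thesis using xyc assms(6) by simp
    qed
  qed

  \<comment> \<open>Translation by \<open>a\<close> as an iterated squaring\<close>
  have A_pow: "A_set ((\<lambda>x. x [^] (2 ^ n :: nat)) ` Z)" if Z: "A_set Z" "Z \<inter> H = {}" for n Z
  proof (induction n)
    case 0
    have "(\<lambda>x. x [^] (2 ^ 0 :: nat)) ` Z = Z" using Z by (force simp: A_set_def)
    then show ?case using Z by simp
  next
    case (Suc n)
    let ?Z = "(\<lambda>x. x [^] (2 ^ n :: nat)) ` Z"
    have Zc: "Z \<subseteq> carrier G" using Z by (simp add: A_set_def)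
    have dbl: "x [^] (2 ^ Suc n :: nat) = x [^] (2 ^ n :: nat) \<otimes> x [^] (2 ^ n :: nat)"
      if "x \<in> carrier G" for x n
      using that by (simp add: nat_pow_mult mult_2)
    \<comment> \<open>All squares lie in \<open>H\<close>, so the image leaves the outer coset at
      the first squaring and stays in \<open>H\<close>. It never meets both cosets, and squaring is
      injective on it.\<close>
    have "?Z \<subseteq> H \<or> ?Z \<inter> H = {}"
    proof (cases n)
      case 0
      have "?Z = Z" using 0 Zc by force
      then show ?thesis using Z by simp
    next
      case (Suc m)
      then show ?thesis using dbl sqH Zc by (auto simp del: power_Suc)
    qed
    then have "A_set ((\<lambda>x. x \<otimes> x) ` ?Z)"
      using Suc Zc by (intro A_set_squares[OF G.comm_group_axioms] inj) auto
    also have "(\<lambda>x. x \<otimes> x) ` ?Z = (\<lambda>x. x [^] (2 ^ Suc n :: nat)) ` Z"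
      unfolding image_image by (rule image_cong[OF refl], rule dbl[symmetric]) (use Zc in blast)
    finally show ?case .
  qed
  \<comment> \<open>Euler's theorem makes \<open>2 ^ k\<close> congruent to 1 modulo the odd number
    \<open>card H\<close>, and \<open>k > 0\<close> makes \<open>2 ^ k\<close> even. This power
    therefore fixes \<open>H\<close> pointwise and sends \<open>a\<close> to
    \<open>\<one>\<close>.\<close>
  define k where "k = totient (card H)"
  have cardH: "card H > 0" using assms(5) odd_pos by blast
  then have "k > 0" by (simp add: k_def)
  have "[2 ^ k = 1] (mod card H)"
    unfolding k_def using assms(5) by (intro euler_theorem) simp
  then have "card H dvd 2 ^ k - 1"
    by (subst (asm) cong_sym_eq, subst (asm) cong_altdef_nat) auto
  then obtain m where "2 ^ k - 1 = card H * m" ..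
  then have m: "2 ^ k = card H * m + 1"
    by (metis Suc_eq_plus1 Suc_pred' zero_less_numeral zero_less_power)
  have pow_H: "x [^] (2 ^ k :: nat) = x \<otimes> a" if x: "x \<in> carrier G" "x \<notin> H" for x
  proof -
    obtain h where h: "h \<in> H" "x = h \<otimes> a" using cases_G[OF x(1)] x(2) by blast
    have "h [^] (card H * m) = (h [^] card H) [^] m" using h by (simp add: nat_pow_pow)
    then have "h [^] (2 ^ k :: nat) = h"
      using h pow_card by (simp add: m)
    moreover have "a [^] (2 ^ k :: nat) = \<one>"
    proof -
      have "(2::nat) ^ k = 2 * 2 ^ (k - 1)" using \<open>k > 0\<close> by (simp add: power_eq_if[of 2 k])
      moreover have "a [^] (2::nat) = \<one>" using aa assms(6) by (simp add: numeral_2_eq_2)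
      ultimately show ?thesis using assms(6) by (metis nat_pow_one nat_pow_pow)
    qed
    ultimately show ?thesis
      using h assms(6) aa by (simp add: G.nat_pow_distrib m_assoc)
  qed
  have A_set_translate: "A_set ((\<lambda>x. x \<otimes> a) ` Z)" if Z: "A_set Z" "Z \<inter> H = {}" for Z
  proof -
    have "(\<lambda>x. x [^] (2 ^ k :: nat)) ` Z = (\<lambda>x. x \<otimes> a) ` Z"
      using pow_H Z by (intro image_cong) (auto simp: A_set_def)
    then show ?thesis using A_pow[OF Z, of k] by simp
  qed

  \<comment> \<open>The set \<open>L\<close> and its action on the basic sets outside
    \<open>H\<close>\<close>
  have H_A_set: "A_set H" using assms(10) by (simp add: A_set_def H.subset)
  obtain X0 where X0: "X0 \<in> S" "a \<in> X0" using basic_set_exists assms(6) by blast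
  have X0H: "X0 \<inter> H = {}" using A_set_mem_iff[OF H_A_set X0(1)] X0(2) aH by blast
  have X0c: "X0 \<subseteq> carrier G" using X0 basic_set_subset by auto
  define L where "L = (\<lambda>x. x \<otimes> a) ` X0"
  have LH: "L \<subseteq> H" using aaH X0c X0H by (auto simp: L_def)
  have L_A_set: "A_set L"
    unfolding L_def using A_set_translate basic_set_A_set X0 X0H by simp
  have L1: "\<one> \<in> L" using X0 aa by (auto simp: L_def intro!: image_eqI[of _ _ a])
  have mem_L: "y \<otimes> a \<in> X0" if "y \<in> L" for y
    using that X0c aa assms(6) by (auto simp: L_def m_assoc)
  have stab: "x \<otimes> y \<in> X" if X: "X \<in> S" "X \<inter> H = {}" "x \<in> X" and y: "y \<in> L" for X x y
  proof -
    have Xc: "X \<subseteq> carrier G" and X_A_set: "A_set X"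
      using X basic_set_subset basic_set_A_set by auto
    have yc: "y \<in> carrier G" using y LH by auto
    define V where "V = set_inv ((\<lambda>x. x \<otimes> a) ` X)"
    have V_A_set: "A_set V"
      unfolding V_def using X X_A_set by (intro A_set_inv A_set_translate)
    have V: "V \<subseteq> carrier G" "finite V"
      using V_A_set finite_subset_carrier by (auto simp: A_set_def)
    \<comment> \<open>If \<open>v = inv (x \<otimes> a)\<close> with \<open>x \<in> X\<close>, then
      \<open>inv v \<otimes> a = x\<close>. Hence all of \<open>V\<close> is counted in the
      coefficient at \<open>a\<close>.\<close>
    have inv_V: "inv v \<otimes> a \<in> X" if "v \<in> V" for v
      using that Xc assms(6) aa by (auto simp: V_def SET_INV_def m_assoc)
    have coeff: "Poly_Mapping.lookup (simple_quantity V \<otimes>\<^bsub>group_ring G\<^esub> simple_quantity X) g =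
        int (card {v \<in> V. inv v \<otimes> g \<in> X})" if "g \<in> carrier G" for g
      using V Xc that finite_subset_carrier by (intro lookup_simple_quantity_mult) auto
    have "{v \<in> V. inv v \<otimes> a \<in> X} = V" using inv_V by auto
    \<comment> \<open>Both \<open>a\<close> and \<open>y \<otimes> a\<close> lie in the basic set
      \<open>X0\<close>, so the coefficients there agree.\<close>
    then have "card {v \<in> V. inv v \<otimes> (y \<otimes> a) \<in> X} = card V"
      using lookup_eq[OF A_set_mult_mem[OF V_A_set X_A_set] X0(1) mem_L[OF y] X0(2)]
        coeff assms(6) yc by simp
    then have *: "inv v \<otimes> (y \<otimes> a) \<in> X" if "v \<in> V" for v
      using card_subset_eq[OF V(2), of "{v \<in> V. inv v \<otimes> (y \<otimes> a) \<in> X}"] that by auto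
    have xc: "x \<in> carrier G" using X Xc by auto
    \<comment> \<open>For this element of \<open>V\<close> the two factors \<open>a\<close> cancel
      and \<open>x \<otimes> y\<close> remains.\<close>
    have "inv (x \<otimes> a) \<in> V" using X by (auto simp: V_def SET_INV_def)
    from *[OF this] have "(x \<otimes> a) \<otimes> (y \<otimes> a) \<in> X" using xc assms(6) by simp
    also have "(x \<otimes> a) \<otimes> (y \<otimes> a) = (x \<otimes> y) \<otimes> (a \<otimes> a)"
      using xc yc assms(6) by (simp add: G.m_ac)
    finally show ?thesis using aa xc yc by simp
  qed

  \<comment> \<open>\<open>L\<close> is a nontrivial subgroup, and the wreath product condition
    holds\<close>
  have L_mult: "y \<otimes> z \<in> L" if "y \<in> L" "z \<in> L" for y z
  proof -
    have yz: "y \<in> carrier G" "z \<in> carrier G" using that LH by auto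
    have "y \<otimes> a \<otimes> z \<in> X0" using stab X0 X0H mem_L that by blast
    moreover have "y \<otimes> a \<otimes> z \<otimes> a = y \<otimes> z \<otimes> (a \<otimes> a)"
      using yz assms(6) by (simp add: G.m_ac)
    ultimately show ?thesis using yz aa by (auto simp: L_def intro: rev_image_eqI)
  qed
  have L_subgroup: "subgroup L G"
  proof (rule subgroupI)
    show "L \<subseteq> carrier G" "L \<noteq> {}" using LH L1 by auto
    show "y \<otimes> z \<in> L" if "y \<in> L" "z \<in> L" for y z using L_mult that .
    show "inv y \<in> L" if y: "y \<in> L" for y
    proof -
      have yc: "y \<in> carrier G" and Lc: "L \<subseteq> carrier G" using y LH by auto
      \<comment> \<open>Left multiplication by \<open>y\<close> is an injective self-map of the
        finite set \<open>L\<close>, hence onto, so it attains \<open>\<one>\<close>.\<close>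
      have "inj_on (\<lambda>z. y \<otimes> z) L" using yc Lc by (simp add: inj_on_def subset_iff)
      moreover have "(\<lambda>z. y \<otimes> z) ` L \<subseteq> L" using L_mult y by auto
      ultimately have "(\<lambda>z. y \<otimes> z) ` L = L"
        using finite_subset_carrier[OF Lc] by (simp add: endo_inj_surj)
      then obtain z where "z \<in> L" "y \<otimes> z = \<one>" using L1 by (metis imageE)
      then show ?thesis using yc Lc G.m_comm inv_equality by (metis subsetD)
    qed
  qed
  have "L \<noteq> {\<one>}"
  proof
    \<comment> \<open>Then the basic set of \<open>a\<close> would be \<open>{a}\<close>, contrary
      to the assumption that its simple quantity is not in \<open>A\<close>.\<close>
    assume L: "L = {\<one>}"
    have "x = a" if "x \<in> X0" for x
    proof -
      have "x \<otimes> a = \<one>" using that L by (auto simp: L_def)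
      then show ?thesis using that X0c aa assms(6) inv_equality by (metis subsetD)
    qed
    then have "X0 = {a}" using X0(2) by blast
    then show False using basic_set_A_set[OF X0(1)] assms(11) by (simp add: A_set_def)
  qed
  moreover have "\<exists>C\<subseteq>rcosets L. X = \<Union>C" if X: "X \<in> S" "X \<subseteq> carrier G - H" for X
  proof (intro exI conjI)
    \<comment> \<open>The cosets are those of the elements of \<open>X\<close>: they cover
      \<open>X\<close> because \<open>\<one> \<in> L\<close>, and \<open>stab\<close> keeps them
      inside \<open>X\<close>.\<close>
    show "(\<lambda>x. L #> x) ` X \<subseteq> rcosets L" using X by (auto simp: RCOSETS_def)
    show "X = \<Union>((\<lambda>x. L #> x) ` X)"
    proof
      show "X \<subseteq> \<Union>((\<lambda>x. L #> x) ` X)"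
        using X L1 by (force simp: r_coset_def)
      have "y \<otimes> x \<in> X" if "x \<in> X" "y \<in> L" for x y
      proof -
        have "x \<in> carrier G" "y \<in> carrier G" using that X LH by auto
        moreover have "x \<otimes> y \<in> X" using stab[OF X(1) _ that] X(2) by blast
        ultimately show ?thesis by (simp add: G.m_comm)
      qed
      then show "\<Union>((\<lambda>x. L #> x) ` X) \<subseteq> X" by (auto simp: r_coset_def)
    qed
  qed
  moreover have "L \<lhd> G" using L_subgroup by (rule G.subgroup_imp_normal)
  ultimately show ?thesis
    using LH L_subgroup L_A_set H_A_set assms(3)
    by (auto simp: wreath_product_def A_subgroup_def A_set_def)
qed

end
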